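(* For $k\in\{2,\dots,n-1\}$, the transition matrix $R_k$ of the $(n-k)$-random-to-random shuffle satisfies, for any $f\in L(\mathfrak S_n)$, $$R_kf=(n-k)!\left(\frac{k!}{n!}\right)^2\sum_{\pi\in\Gamma^k}\langle f,\mathbf 1_{\mathfrak S_n(\pi)}\rangle\,\mathbf 1_{\mathfrak S_n(\pi)}.$$
   Context: Let $[n]=\{1,\dots,n\}$ and let $L(\mathfrak S_n)$ be the space of real functions on the symmetric group with inner product $\langle f,g\rangle=\sum_\sigma f(\sigma)g(\sigma)$; $\delta_\sigma$ is the Dirac function at $\sigma$ and $\mathbf 1_S$ the indicator of $S$. An injective word is a finite sequence of distinct elements of $[n]$; $\Gamma^k$ is the set of injective words of length $k$. A permutation is identified with a word of length $n$ (a configuration of a deck of $n$ cards). For an injective word $\pi$, $\pi\subset\sigma$ means that $\pi$ is a (not necessarily contiguous) subword of $\sigma$, and $\mathfrak S_n(\pi)=\{\sigma\in\mathfrak S_n:\pi\subset\sigma\}$. For $m\in\{1,\dots,n-2\}$, the $m$-random-to-random shuffle consists in picking $m$ cards uniformly at random from the deck and replacing them at random positions and in a random order in the deck: if $A$ is the (uniformly random) set of the $n-m$ cards that were not picked and $\sigma_{|A}$ is the subword of $\sigma$ with set of letters $A$, the new configuration is uniformly distributed over $\mathfrak S_n(\sigma_{|A})$. Its transition matrix acts linearly on $L(\mathfrak S_n)$ by sending $\delta_\sigma$ to the probability mass function of the configuration obtained after one shuffle started from $\sigma$. *)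

theory Defs
  imports
    "HOL-Probability.Probability"
    "HOL-Library.Sublist"
    "HOL-Combinatorics.Multiset_Permutations"
begin

text \<open>
  Permutations are words (configurations of the deck): the symmetric group on [n] is
  \<^term>\<open>permutations_of_set {1..n}\<close>, the set of the lists without repetition whose letters
  are exactly 1, ..., n.
\<close>

abbreviation Sym :: "nat \<Rightarrow> nat list set"
  where "Sym n \<equiv> permutations_of_set {1..n}"

text \<open>
  Real functions on the symmetric group are represented by their extension by zero to all words,
  so that equality of functions on the symmetric group is plain equality.
\<close>

definition L_Sym :: "nat \<Rightarrow> (nat list \<Rightarrow> real) set"
  where "L_Sym n = {f. \<forall>w. w \<notin> Sym n \<longrightarrow> f w = 0}"

definition inner_Sym :: "nat \<Rightarrow> (nat list \<Rightarrow> real) \<Rightarrow> (nat list \<Rightarrow> real) \<Rightarrow> real"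
  where "inner_Sym n f g = (\<Sum>\<sigma>\<in>Sym n. f \<sigma> * g \<sigma>)"

definition dirac :: "nat list \<Rightarrow> nat list \<Rightarrow> real"
  where "dirac \<sigma> = indicator {\<sigma>}"

definition inj_words :: "nat \<Rightarrow> nat \<Rightarrow> nat list set"
  where "inj_words n k = {\<pi>. distinct \<pi> \<and> set \<pi> \<subseteq> {1..n} \<and> length \<pi> = k}"

definition Sym_containing :: "nat \<Rightarrow> nat list \<Rightarrow> nat list set"
  where "Sym_containing n \<pi> = {\<sigma> \<in> Sym n. subseq \<pi> \<sigma>}"

definition restrict_word :: "nat list \<Rightarrow> nat set \<Rightarrow> nat list"
  where "restrict_word \<sigma> A = filter (\<lambda>c. c \<in> A) \<sigma>"

text \<open>
  Distribution of the deck after one m-random-to-random shuffle started from \<open>\<sigma>\<close>;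
  \<open>B\<close> is the set of the cards picked.
\<close>

definition random_to_random :: "nat \<Rightarrow> nat \<Rightarrow> nat list \<Rightarrow> nat list pmf"
  where "random_to_random n m \<sigma> =
    pmf_of_set {B. B \<subseteq> {1..n} \<and> card B = m} \<bind>
      (\<lambda>B. pmf_of_set (Sym_containing n (restrict_word \<sigma> ({1..n} - B))))"

text \<open>
  The action of the transition matrix of the m-random-to-random shuffle is the linear extension
  of the map sending the Dirac function at \<open>\<sigma>\<close> to the probability mass function of the
  configuration after one shuffle started from \<open>\<sigma>\<close>.
\<close>

definition transition_op :: "nat \<Rightarrow> nat \<Rightarrow> (nat list \<Rightarrow> real) \<Rightarrow> nat list \<Rightarrow> real"
  where "transition_op n m f = (\<lambda>\<tau>. \<Sum>\<sigma>\<in>Sym n. f \<sigma> * pmf (random_to_random n m \<sigma>) \<tau>)"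

lemma transition_op_dirac:
  assumes "\<sigma> \<in> Sym n"
  shows "transition_op n m (dirac \<sigma>) = pmf (random_to_random n m \<sigma>)"
proof
  fix \<tau>
  have "transition_op n m (dirac \<sigma>) \<tau> =
      (\<Sum>\<sigma>'\<in>Sym n. if \<sigma>' = \<sigma> then pmf (random_to_random n m \<sigma>') \<tau> else 0)"
    unfolding transition_op_def dirac_def by (intro sum.cong) (auto simp: indicator_def)
  with assms show "transition_op n m (dirac \<sigma>) \<tau> = pmf (random_to_random n m \<sigma>) \<tau>"
    by simp
qed

lemma transition_op_linear:
  "transition_op n m (\<lambda>\<sigma>. a * f \<sigma> + b * g \<sigma>) =
    (\<lambda>\<tau>. a * transition_op n m f \<tau> + b * transition_op n m g \<tau>)"
  by (simp add: transition_op_def sum_distrib_left sum.distrib algebra_simps)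

definition R :: "nat \<Rightarrow> nat \<Rightarrow> (nat list \<Rightarrow> real) \<Rightarrow> nat list \<Rightarrow> real"
  where "R n k = transition_op n (n - k)"

end

theory Submission
  imports Defs
begin

text \<open>
  Two facts carry the proof. The first is a count: for a set of letters \<open>A\<close> with \<open>k\<close> elements,
  every configuration of the deck contains exactly one arrangement of \<open>A\<close>, namely its restriction
  to \<open>A\<close>, and relabelling the cards shows that all \<open>k!\<close> arrangements are contained in equally many
  configurations. Hence each word \<open>\<pi>\<close> of length \<open>k\<close> is contained in \<open>n! / k!\<close> of them
  (\<open>card_Sym_containing\<close>), and the second step of the shuffle chooses each of these with
  probability \<open>k! / n!\<close>.

  The second is a change of variable: starting from \<open>\<sigma>\<close>, the choice of the \<open>k\<close> cards that are
  not picked is the same as the choice of a subword of \<open>\<sigma>\<close> of length \<open>k\<close> (\<open>bij_betw_picked_cards_subwords\<close>),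
  made with probability \<open>1 / (n choose k)\<close>. The transition probability from \<open>\<sigma>\<close> to \<open>\<tau>\<close> is therefore
  the number of common subwords of length \<open>k\<close>, times
  \<open>(k! / n!) / (n choose k) = (n - k)! (k! / n!)\<^sup>2\<close>
  (\<open>pmf_random_to_random\<close>). Writing this number as the sum over \<open>\<pi>\<close> of the product of the two
  indicators and exchanging the sums over \<open>\<sigma>\<close> and \<open>\<pi>\<close> gives the formula.
\<close>

text \<open>
  Since letters do not repeat, a subword of \<open>\<sigma>\<close> is determined by its set of letters; this is what
  lets subwords stand for sets of cards.
\<close>

lemma subseq_iff_restrict_word:
  assumes "distinct \<sigma>" "distinct \<pi>" "set \<pi> \<subseteq> set \<sigma>"
  shows "subseq \<pi> \<sigma> \<longleftrightarrow> restrict_word \<sigma> (set \<pi>) = \<pi>"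
proof
  assume "subseq \<pi> \<sigma>"
  then have "subseq (filter (\<lambda>c. c \<in> set \<pi>) \<pi>) (filter (\<lambda>c. c \<in> set \<pi>) \<sigma>)"
    by (rule subseq_filter)
  moreover have "filter (\<lambda>c. c \<in> set \<pi>) \<pi> = \<pi>"
    by (simp add: filter_id_conv)
  ultimately have sub: "subseq \<pi> (restrict_word \<sigma> (set \<pi>))"
    by (simp add: restrict_word_def)
  have "set (restrict_word \<sigma> (set \<pi>)) = set \<pi>"
    using assms(3) by (auto simp: restrict_word_def)
  moreover have "distinct (restrict_word \<sigma> (set \<pi>))"
    using assms(1) by (simp add: restrict_word_def)
  ultimately have "length \<pi> = length (restrict_word \<sigma> (set \<pi>))"
    using assms(2) by (metis distinct_card)
  with sub show "restrict_word \<sigma> (set \<pi>) = \<pi>"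
    by (rule subseq_same_length[symmetric])
next
  assume "restrict_word \<sigma> (set \<pi>) = \<pi>"
  then show "subseq \<pi> \<sigma>"
    unfolding restrict_word_def by (metis subseq_filter_left)
qed

lemma Sym_containing_altdef:
  assumes "distinct \<pi>" "set \<pi> \<subseteq> {1..n}"
  shows "Sym_containing n \<pi> = {\<sigma> \<in> Sym n. restrict_word \<sigma> (set \<pi>) = \<pi>}"
  using assms unfolding Sym_containing_def
  by (auto simp: permutations_of_set_def subseq_iff_restrict_word)

text \<open>
  The relabelling of the cards that turns \<open>\<pi>\<close> into \<open>\<pi>'\<close> maps configurations containing \<open>\<pi>\<close>
  injectively to configurations containing \<open>\<pi>'\<close>. An inequality is enough, because
  \<open>\<pi>\<close> and \<open>\<pi>'\<close> can be exchanged.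
\<close>

lemma card_Sym_containing_le:
  assumes "\<pi> \<in> permutations_of_set A" "\<pi>' \<in> permutations_of_set A" "A \<subseteq> {1..n}"
  shows "card (Sym_containing n \<pi>) \<le> card (Sym_containing n \<pi>')"
proof -
  have \<pi>: "set \<pi> = A" "distinct \<pi>" and \<pi>': "set \<pi>' = A" "distinct \<pi>'"
    using assms by (auto simp: permutations_of_set_def)
  have len: "length \<pi> = length \<pi>'"
    using \<pi> \<pi>' by (metis distinct_card)
  define g where "g = permutation_of_list (zip \<pi> \<pi>')"
  have "list_permutes (zip \<pi> \<pi>') {1..n}"
    using \<pi> \<pi>' len assms(3) by (simp add: list_permutes_def)
  then have perm: "g permutes {1..n}"
    unfolding g_def by (rule permutation_of_list_permutes)
  have map_g: "map g \<pi> = \<pi>'"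
  proof (rule nth_equalityI)
    fix i assume "i < length (map g \<pi>)"
    then show "map g \<pi> ! i = \<pi>' ! i"
      using \<pi>(2) len
      by (simp add: g_def permutation_of_list_def map_of_zip_nth)
  qed (simp add: len)
  have inj: "inj_on (map g) (Sym_containing n \<pi>)"
    using permutes_inj[OF perm] by (simp add: inj_on_def inj_map_eq_map)
  have "map g ` Sym_containing n \<pi> \<subseteq> Sym_containing n \<pi>'"
  proof
    fix \<tau> assume "\<tau> \<in> map g ` Sym_containing n \<pi>"
    then obtain \<sigma> where \<sigma>: "\<sigma> \<in> Sym n" "subseq \<pi> \<sigma>" and \<tau>: "\<tau> = map g \<sigma>"
      by (auto simp: Sym_containing_def)
    have "\<tau> \<in> Sym n"
      using \<sigma>(1) perm unfolding \<tau> permutations_of_set_def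
      by (simp add: distinct_map permutes_image permutes_inj_on)
    moreover have "subseq \<pi>' \<tau>"
      using subseq_map[OF \<sigma>(2), of g] by (simp add: map_g \<tau>)
    ultimately show "\<tau> \<in> Sym_containing n \<pi>'"
      by (simp add: Sym_containing_def)
  qed
  moreover have "finite (Sym_containing n \<pi>')"
    by (simp add: Sym_containing_def)
  ultimately show ?thesis
    using card_inj_on_le[OF inj] by blast
qed

text \<open>
  The sets of configurations containing the various arrangements of \<open>set \<pi>\<close> partition the
  symmetric group and have the same size.
\<close>

lemma card_Sym_containing:
  assumes "\<pi> \<in> inj_words n k"
  shows "fact k * card (Sym_containing n \<pi>) = fact n"
proof -
  define A where "A = set \<pi>"
  have A: "A \<subseteq> {1..n}" "finite A" "card A = k" and \<pi>: "\<pi> \<in> permutations_of_set A"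
    using assms by (auto simp: A_def inj_words_def permutations_of_set_def distinct_card)
  have alt: "Sym_containing n \<rho> = {\<sigma> \<in> Sym n. restrict_word \<sigma> A = \<rho>}"
    if "\<rho> \<in> permutations_of_set A" for \<rho>
    using Sym_containing_altdef[of \<rho> n] that A(1) by (simp add: permutations_of_set_def)
  have maps: "restrict_word \<sigma> A \<in> permutations_of_set A" if "\<sigma> \<in> Sym n" for \<sigma>
    using that A(1) by (auto simp: permutations_of_set_def restrict_word_def)
  have "fact n = card (Sym n)"
    by simp
  also have "Sym n = (\<Union>\<rho>\<in>permutations_of_set A. Sym_containing n \<rho>)"
    using maps by (auto simp: alt)
  also have "card \<dots> = (\<Sum>\<rho>\<in>permutations_of_set A. card (Sym_containing n \<rho>))"
    by (rule card_UN_disjoint) (auto simp: alt)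
  also have "\<dots> = (\<Sum>\<rho>\<in>permutations_of_set A. card (Sym_containing n \<pi>))"
    by (intro sum.cong refl antisym card_Sym_containing_le[OF _ _ A(1)] \<pi>)
  also have "\<dots> = fact k * card (Sym_containing n \<pi>)"
    using A by simp
  finally show ?thesis
    by simp
qed

lemma finite_inj_words: "finite (inj_words n k)"
proof (rule finite_subset)
  show "inj_words n k \<subseteq> {\<pi>. set \<pi> \<subseteq> {1..n} \<and> length \<pi> = k}"
    by (auto simp: inj_words_def)
qed (simp add: finite_lists_length_eq)

text \<open>The inverse map sends a subword to the set of the cards that it does not use.\<close>

lemma bij_betw_picked_cards_subwords:
  assumes "\<sigma> \<in> Sym n" "k \<le> n"
  shows "bij_betw (\<lambda>B. restrict_word \<sigma> ({1..n} - B))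
    {B. B \<subseteq> {1..n} \<and> card B = n - k} {\<pi> \<in> inj_words n k. subseq \<pi> \<sigma>}"
proof -
  have \<sigma>: "distinct \<sigma>" "set \<sigma> = {1..n}"
    using assms(1) by (auto simp: permutations_of_set_def)
  have set_restrict: "set (restrict_word \<sigma> ({1..n} - B)) = {1..n} - B" for B
    unfolding restrict_word_def set_filter \<sigma>(2) by blast
  show ?thesis
  proof (rule bij_betw_byWitness[where f' = "\<lambda>\<pi>. {1..n} - set \<pi>"])
    show "\<forall>B\<in>{B. B \<subseteq> {1..n} \<and> card B = n - k}.
        {1..n} - set (restrict_word \<sigma> ({1..n} - B)) = B"
      unfolding set_restrict by auto
    show "\<forall>\<pi>\<in>{\<pi> \<in> inj_words n k. subseq \<pi> \<sigma>}.
        restrict_word \<sigma> ({1..n} - ({1..n} - set \<pi>)) = \<pi>"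
      using \<sigma> by (auto simp: inj_words_def double_diff subseq_iff_restrict_word)
    show "(\<lambda>B. restrict_word \<sigma> ({1..n} - B)) ` {B. B \<subseteq> {1..n} \<and> card B = n - k}
        \<subseteq> {\<pi> \<in> inj_words n k. subseq \<pi> \<sigma>}"
    proof clarify
      fix B assume B: "B \<subseteq> {1..n}" "card B = n - k"
      have "card ({1..n} - B) = k"
        using B assms(2) by (simp add: card_Diff_subset finite_subset)
      moreover have dist: "distinct (restrict_word \<sigma> ({1..n} - B))"
        using \<sigma> by (simp add: restrict_word_def)
      ultimately have "length (restrict_word \<sigma> ({1..n} - B)) = k"
        using distinct_card[OF dist] by (simp only: set_restrict)
      moreover have "subseq (restrict_word \<sigma> ({1..n} - B)) \<sigma>"
        by (simp add: restrict_word_def)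
      ultimately show "restrict_word \<sigma> ({1..n} - B) \<in> inj_words n k \<and>
          subseq (restrict_word \<sigma> ({1..n} - B)) \<sigma>"
        using dist set_restrict[of B] by (auto simp: inj_words_def)
    qed
    show "(\<lambda>\<pi>. {1..n} - set \<pi>) ` {\<pi> \<in> inj_words n k. subseq \<pi> \<sigma>}
        \<subseteq> {B. B \<subseteq> {1..n} \<and> card B = n - k}"
      by (auto simp: inj_words_def card_Diff_subset distinct_card)
  qed
qed

text \<open>
  The sum counts the common subwords of length \<open>k\<close> of \<open>\<sigma>\<close> and \<open>\<tau>\<close>. Letting it run over all words
  of length \<open>k\<close>, with an indicator for \<open>\<sigma>\<close>, makes its range independent of \<open>\<sigma>\<close>, so that it can be
  exchanged with a sum over \<open>\<sigma>\<close>.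
\<close>

lemma pmf_random_to_random:
  assumes "\<sigma> \<in> Sym n" "k \<le> n"
  shows "pmf (random_to_random n (n - k) \<sigma>) \<tau> =
    fact (n - k) * (fact k / fact n)\<^sup>2 *
      (\<Sum>\<pi>\<in>inj_words n k.
        indicator (Sym_containing n \<pi>) \<sigma> * indicator (Sym_containing n \<pi>) \<tau>)"
proof -
  define P where "P = {B. B \<subseteq> {1..n} \<and> card B = n - k}"
  define W where "W = {\<pi> \<in> inj_words n k. subseq \<pi> \<sigma>}"
  define r where "r B = restrict_word \<sigma> ({1..n} - B)" for B
  have bij: "bij_betw r P W"
    using bij_betw_picked_cards_subwords[OF assms] by (simp only: P_def W_def r_def[abs_def])
  have card_P: "card P = n choose k"
    using n_subsets[of "{1..n}" "n - k"] binomial_symmetric[OF assms(2)] by (simp add: P_def)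
  have fin_P: "finite P"
    by (simp add: P_def)
  have "card P > 0"
    using assms(2) by (simp add: card_P)
  then have ne_P: "P \<noteq> {}"
    by auto
  have uniform: "pmf (pmf_of_set (Sym_containing n \<pi>)) \<tau> =
      (fact k / fact n) * indicator (Sym_containing n \<pi>) \<tau>" if "\<pi> \<in> W" for \<pi>
  proof -
    have "real (fact k * card (Sym_containing n \<pi>)) = real (fact n)"
      using that card_Sym_containing[of \<pi> n k] by (simp only: W_def mem_Collect_eq)
    then have card: "fact k * real (card (Sym_containing n \<pi>)) = fact n"
      by simp
    have "\<sigma> \<in> Sym_containing n \<pi>"
      using that assms(1) by (simp add: W_def Sym_containing_def)
    moreover have "finite (Sym_containing n \<pi>)"
      by (simp add: Sym_containing_def)
    ultimately have "pmf (pmf_of_set (Sym_containing n \<pi>)) \<tau> =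
        indicator (Sym_containing n \<pi>) \<tau> / real (card (Sym_containing n \<pi>))"
      by (intro pmf_of_set) auto
    then show ?thesis
      by (simp flip: card)
  qed
  have "pmf (random_to_random n (n - k) \<sigma>) \<tau> =
      (\<Sum>B\<in>P. pmf (pmf_of_set (Sym_containing n (r B))) \<tau>) / real (card P)"
    unfolding random_to_random_def P_def[symmetric] r_def
    by (rule pmf_bind_pmf_of_set[OF ne_P fin_P])
  also have "\<dots> = (\<Sum>\<pi>\<in>W. pmf (pmf_of_set (Sym_containing n \<pi>)) \<tau>) / real (n choose k)"
    using sum.reindex_bij_betw[OF bij, of "\<lambda>\<pi>. pmf (pmf_of_set (Sym_containing n \<pi>)) \<tau>"]
    by (simp only: card_P)
  also have "\<dots> = (fact k / fact n) / real (n choose k) *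
      (\<Sum>\<pi>\<in>W. indicator (Sym_containing n \<pi>) \<tau>)"
    by (simp add: uniform sum_distrib_left sum_divide_distrib)
  also have "(\<Sum>\<pi>\<in>W. indicator (Sym_containing n \<pi>) \<tau>) =
      (\<Sum>\<pi>\<in>inj_words n k.
        indicator (Sym_containing n \<pi>) \<sigma> * indicator (Sym_containing n \<pi>) \<tau> :: real)"
    using assms(1) unfolding W_def
    by (intro sum.mono_neutral_cong_left)
      (auto simp: finite_inj_words Sym_containing_def indicator_def)
  also have "(fact k / fact n) / real (n choose k) = fact (n - k) * (fact k / fact n)\<^sup>2"
    using assms(2) by (simp add: binomial_fact power2_eq_square)
  finally show ?thesis .
qed

theorem proposition37:
  fixes n k :: nat and f :: "nat list \<Rightarrow> real"
  assumes "k \<in> {2..n - 1}"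
    and "f \<in> L_Sym n"
  shows "R n k f =
    (\<lambda>\<tau>. fact (n - k) * (fact k / fact n)\<^sup>2 *
      (\<Sum>\<pi>\<in>inj_words n k.
        inner_Sym n f (indicator (Sym_containing n \<pi>)) * indicator (Sym_containing n \<pi>) \<tau>))"
proof
  fix \<tau>
  define c :: real where "c = fact (n - k) * (fact k / fact n)\<^sup>2"
  define I :: "nat list \<Rightarrow> nat list \<Rightarrow> real" where "I \<pi> = indicator (Sym_containing n \<pi>)" for \<pi>
  have "k \<le> n"
    using assms(1) by auto
  then have "R n k f \<tau> = (\<Sum>\<sigma>\<in>Sym n. f \<sigma> * (c * (\<Sum>\<pi>\<in>inj_words n k. I \<pi> \<sigma> * I \<pi> \<tau>)))"
    unfolding R_def transition_op_def c_def I_def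
    by (intro sum.cong refl arg_cong2[where f = "(*)"] pmf_random_to_random)
  also have "\<dots> = (\<Sum>\<sigma>\<in>Sym n. \<Sum>\<pi>\<in>inj_words n k. c * (f \<sigma> * I \<pi> \<sigma> * I \<pi> \<tau>))"
    by (simp add: sum_distrib_left mult_ac)
  also have "\<dots> = (\<Sum>\<pi>\<in>inj_words n k. \<Sum>\<sigma>\<in>Sym n. c * (f \<sigma> * I \<pi> \<sigma> * I \<pi> \<tau>))"
    by (rule sum.swap)
  also have "\<dots> = c * (\<Sum>\<pi>\<in>inj_words n k. inner_Sym n f (I \<pi>) * I \<pi> \<tau>)"
    by (simp add: inner_Sym_def sum_distrib_left sum_distrib_right)
  finally show "R n k f \<tau> = fact (n - k) * (fact k / fact n)\<^sup>2 *
      (\<Sum>\<pi>\<in>inj_words n k.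
        inner_Sym n f (indicator (Sym_containing n \<pi>)) * indicator (Sym_containing n \<pi>) \<tau>)"
    by (simp add: c_def I_def)
qed

end
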